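(* Let $(H,\langle\cdot,\cdot\rangle)$ be a real or complex inner product space over $\mathbb{K}$ ($\mathbb{K}=\mathbb{R}$ or $\mathbb{K}=\mathbb{C}$), and let $a,b\in H$ be two linearly independent vectors. If $x\in H$ is such that $$\langle x,a\rangle=0\quad\text{and}\quad \|x\|=1,$$ then $$\frac{\|a\|^{2}\|b\|^{2}-|\langle a,b\rangle|^{2}}{\|a\|^{2}}\ \geq\ |\langle x,b\rangle|^{2}.$$ Moreover, equality holds in this inequality if and only if there is a scalar $\nu\in\mathbb{K}$ with $$|\nu|=\frac{\|a\|}{\left[\|a\|^{2}\|b\|^{2}-|\langle a,b\rangle|^{2}\right]^{1/2}}$$ such that $$x=\nu\left(b-\frac{\overline{\langle a,b\rangle}}{\|a\|^{2}}\,a\right).$$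
   Context: The inner product is linear in its first argument and conjugate-linear in its second (in the complex case), and $\|u\|=\langle u,u\rangle^{1/2}$. The space $H$ is not assumed complete. *)

theory Defs
  imports "HOL-Analysis.Analysis"
begin

text \<open>
  The complex counterpart of \<open>real_inner\<close>; completeness is not required. The inner product is
  linear in the first argument and conjugate-linear in the second. By conjugate symmetry
  \<open>cinner x x\<close> is real, so taking \<open>Re\<close> below loses nothing.
\<close>

locale complex_inner_space = vector_space scaleC
  for scaleC :: "complex \<Rightarrow> 'a \<Rightarrow> 'a::ab_group_add" +
  fixes cinner :: "'a \<Rightarrow> 'a \<Rightarrow> complex"
  assumes cinner_commute: "cinner x y = cnj (cinner y x)"
    and cinner_add_left: "cinner (x + y) z = cinner x z + cinner y z"
    and cinner_scaleC_left: "cinner (scaleC c x) y = c * cinner x y"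
    and cinner_ge_zero: "0 \<le> Re (cinner x x)"
    and cinner_eq_zero_iff: "cinner x x = 0 \<longleftrightarrow> x = 0"

definition cnorm :: "('a \<Rightarrow> 'a \<Rightarrow> complex) \<Rightarrow> 'a \<Rightarrow> real"
  where "cnorm cinner x = sqrt (Re (cinner x x))"

lemma complex_inner_space_complex: "complex_inner_space (*) (\<lambda>x y :: complex. x * cnj y)"
  by standard (auto simp: algebra_simps)

end

theory Submission
  imports Defs
begin

text \<open>
  Let \<open>y\<close> be the component of \<open>b\<close> orthogonal to \<open>a\<close>. It is nonzero by linear independence, and
  the quotient on the left-hand side is \<open>\<parallel>y\<parallel>\<^sup>2\<close>. Since \<open>x\<close> is orthogonal to \<open>a\<close>, \<open>\<langle>x, b\<rangle> = \<langle>x, y\<rangle>\<close>, so the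
  claim is the Cauchy-Schwarz inequality for the unit vector \<open>x\<close> and \<open>y\<close> with its equality case,
  which in turn is read off from \<open>\<parallel>y - \<langle>y, x\<rangle> x\<parallel>\<^sup>2 = \<parallel>y\<parallel>\<^sup>2 - \<bar>\<langle>y, x\<rangle>\<bar>\<^sup>2\<close>.
\<close>

text \<open>Turns the prescribed modulus of the scalar into the reciprocal of a norm: it is applied
  with \<open>n\<close> the norm of \<open>a\<close> and \<open>r\<close> the norm of
  \<open>y\<close>. For \<open>r = 0\<close> both sides are 0 by the convention on division.\<close>

lemma norm_over_sqrt_quotient:
  fixes n d r :: real
  assumes "r\<^sup>2 = d / n\<^sup>2" "0 < n" "0 \<le> r"
  shows "n / sqrt d = 1 / r"
proof -
  have "d = (n * r)\<^sup>2"
    using assms by (simp add: power_mult_distrib)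
  then have "sqrt d = n * r"
    using assms by (simp add: real_sqrt_mult)
  then show ?thesis
    using assms by simp
qed

text \<open>Pythagoras for the projection of \<open>v\<close> onto the line of \<open>u\<close>. It
  serves twice: with \<open>u = a\<close> it identifies the quotient in the bound, with
  \<open>u = x\<close> it settles the equality case.\<close>

lemma norm_orthogonal_component_sq:
  fixes u v :: "'a::real_inner"
  assumes "u \<noteq> 0"
  shows "(norm (v - (inner v u / (norm u)\<^sup>2) *\<^sub>R u))\<^sup>2 = (norm v)\<^sup>2 - (inner v u)\<^sup>2 / (norm u)\<^sup>2"
proof -
  define n where "n = (norm u)\<^sup>2"
  have "n \<noteq> 0" "inner u u = n"
    using assms by (simp_all add: n_def power2_norm_eq_inner)
  then show ?thesis
    unfolding n_def[symmetric] power2_norm_eq_inner[of v] power2_norm_eq_inner[of "_ - _"]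
    by (simp add: inner_diff_left inner_diff_right inner_commute[of u v] power2_eq_square)
qed

lemma Cauchy_Schwarz_unit_eq_iff:
  fixes x y :: "'a::real_inner"
  assumes "norm x = 1" "y \<noteq> 0"
  shows "(inner x y)\<^sup>2 = (norm y)\<^sup>2 \<longleftrightarrow> (\<exists>\<nu>. \<bar>\<nu>\<bar> = 1 / norm y \<and> x = \<nu> *\<^sub>R y)"
proof
  assume eq: "(inner x y)\<^sup>2 = (norm y)\<^sup>2"
  define c where "c = inner y x"
  have "(norm (y - c *\<^sub>R x))\<^sup>2 = 0"
    using norm_orthogonal_component_sq[of x y] assms eq
    by (force simp: c_def inner_commute)
  then have y: "y = c *\<^sub>R x"
    by simp
  \<comment> \<open>Here \<open>c\<close> is nonzero because \<open>y\<close> is, so the relation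
    can be inverted; \<open>x\<close> being a unit vector gives the modulus of the witness
    \<open>1 / c\<close>.\<close>
  then have "norm y = \<bar>c\<bar>" "x = (1 / c) *\<^sub>R y"
    using assms by auto
  then show "\<exists>\<nu>. \<bar>\<nu>\<bar> = 1 / norm y \<and> x = \<nu> *\<^sub>R y"
    by (intro exI[of _ "1 / c"]) auto
next
  assume "\<exists>\<nu>. \<bar>\<nu>\<bar> = 1 / norm y \<and> x = \<nu> *\<^sub>R y"
  then obtain \<nu> where \<nu>: "\<bar>\<nu>\<bar> = 1 / norm y" "x = \<nu> *\<^sub>R y"
    by blast
  \<comment> \<open>The inner product is \<open>\<nu>\<close> times the square of
    \<open>norm y\<close>, and the modulus of \<open>\<nu>\<close> cancels one factor.\<close>
  have "\<bar>inner x y\<bar> = norm y"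
    using \<nu> assms by (simp add: abs_mult dot_square_norm power2_eq_square)
  then show "(inner x y)\<^sup>2 = (norm y)\<^sup>2"
    by (metis power2_abs)
qed

text \<open>The premise \<open>a \<noteq> b\<close> accompanies independence because
  \<open>{a, b}\<close> is a set: equal nonzero vectors would collapse to an independent
  singleton.\<close>

lemma real_orthogonal_unit_bound:
  fixes a b x :: "'a::real_inner"
  assumes ab: "a \<noteq> b" "independent {a, b}" and x: "inner x a = 0" "norm x = 1"
  defines "D \<equiv> (norm a)\<^sup>2 * (norm b)\<^sup>2 - \<bar>inner a b\<bar>\<^sup>2"
  shows "\<bar>inner x b\<bar>\<^sup>2 \<le> D / (norm a)\<^sup>2"
    and "D / (norm a)\<^sup>2 = \<bar>inner x b\<bar>\<^sup>2 \<longleftrightarrow>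
      (\<exists>\<nu>. \<bar>\<nu>\<bar> = norm a / sqrt D \<and> x = \<nu> *\<^sub>R (b - (inner a b / (norm a)\<^sup>2) *\<^sub>R a))"
proof -
  define c where "c = inner a b / (norm a)\<^sup>2"
  define y where "y = b - c *\<^sub>R a"
  have a0: "a \<noteq> 0"
    using ab dependent_zero by blast
  \<comment> \<open>Reordering the pair makes \<open>b\<close> the inserted vector. If
    \<open>y\<close> vanished, \<open>b\<close> would be a multiple of \<open>a\<close>.\<close>
  have "b \<notin> span {a}"
    using ab by (metis independent_insert insert_commute singletonD)
  then have y0: "y \<noteq> 0"
    by (auto simp: y_def span_singleton)
  have ny: "(norm y)\<^sup>2 = D / (norm a)\<^sup>2"
    using norm_orthogonal_component_sq[OF a0, of b] a0
    by (simp add: y_def c_def D_def inner_commute diff_divide_distrib)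
  have xy: "inner x b = inner x y"
    using x by (simp add: y_def inner_diff_right)
  have "\<bar>inner x y\<bar> \<le> norm y"
    using Cauchy_Schwarz_ineq2[of x y] x by simp
  then show "\<bar>inner x b\<bar>\<^sup>2 \<le> D / (norm a)\<^sup>2"
    unfolding ny[symmetric] xy by (rule power_mono) simp
  have "norm a / sqrt D = 1 / norm y"
    using ny a0 by (intro norm_over_sqrt_quotient) auto
  then show "D / (norm a)\<^sup>2 = \<bar>inner x b\<bar>\<^sup>2 \<longleftrightarrow>
      (\<exists>\<nu>. \<bar>\<nu>\<bar> = norm a / sqrt D \<and> x = \<nu> *\<^sub>R (b - (inner a b / (norm a)\<^sup>2) *\<^sub>R a))"
    using Cauchy_Schwarz_unit_eq_iff[OF x(2) y0]
    unfolding ny[symmetric] xy c_def[symmetric] y_def[symmetric] by auto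
qed

context complex_inner_space
begin

lemma cinner_add_right: "cinner x (y + z) = cinner x y + cinner x z"
  by (metis cinner_add_left cinner_commute complex_cnj_add)

lemma cinner_scaleC_right: "cinner x (scaleC c y) = cnj c * cinner x y"
  by (metis cinner_commute cinner_scaleC_left complex_cnj_mult)

lemma cinner_diff_left: "cinner (x - y) z = cinner x z - cinner y z"
  by (metis add_diff_cancel_right' cinner_add_left diff_add_cancel)

lemma cinner_diff_right: "cinner x (y - z) = cinner x y - cinner x z"
  by (metis add_diff_cancel_right' cinner_add_right diff_add_cancel)

text \<open>Conjugate symmetry kills the imaginary part. Norm identities can thus be computed in the
  complex numbers, where sesquilinearity applies, and pulled back by injectivity of
  \<open>of_real\<close>.\<close>

lemma cinner_self: "cinner x x = of_real ((cnorm cinner x)\<^sup>2)"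
proof -
  have "Im (cinner x x) = 0"
    using arg_cong[OF cinner_commute[of x x], of Im] by simp
  then show ?thesis
    using cinner_ge_zero[of x] by (simp add: cnorm_def complex_eq_iff)
qed

lemma cnorm_nonneg: "0 \<le> cnorm cinner x"
  by (simp add: cnorm_def cinner_ge_zero)

lemma cnorm_eq_zero_iff: "cnorm cinner x = 0 \<longleftrightarrow> x = 0"
  using cinner_eq_zero_iff[of x] by (simp add: cinner_self)

lemma cnorm_scaleC: "cnorm cinner (scaleC c x) = cmod c * cnorm cinner x"
proof -
  have "complex_of_real ((cnorm cinner (scaleC c x))\<^sup>2) = of_real ((cmod c * cnorm cinner x)\<^sup>2)"
    unfolding cinner_self[symmetric] cinner_scaleC_left cinner_scaleC_right
    by (simp add: cinner_self power_mult_distrib mult.commute[of "cnj c"] flip: complex_norm_square)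
  then have "(cnorm cinner (scaleC c x))\<^sup>2 = (cmod c * cnorm cinner x)\<^sup>2"
    by (simp only: of_real_eq_iff)
  then show ?thesis
    by (simp add: cnorm_nonneg)
qed

lemma cmod_cinner_commute: "cmod (cinner x y) = cmod (cinner y x)"
  by (metis cinner_commute complex_mod_cnj)

text \<open>Linearity in the first argument dictates the coefficient \<open>cinner v u\<close>, not
  its conjugate: only then is the difference orthogonal to \<open>u\<close>.\<close>

lemma cnorm_orthogonal_component_sq:
  assumes "u \<noteq> 0"
  shows "(cnorm cinner (v - scaleC (cinner v u / of_real ((cnorm cinner u)\<^sup>2)) u))\<^sup>2
    = (cnorm cinner v)\<^sup>2 - (cmod (cinner v u))\<^sup>2 / (cnorm cinner u)\<^sup>2"
proof -
  define n where "n = cnorm cinner u"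
  define s where "s = cinner v u"
  have n: "n \<noteq> 0"
    using assms by (simp add: n_def cnorm_eq_zero_iff)
  define w where "w = v - scaleC (s / of_real (n\<^sup>2)) u"
  have "cinner u v = cnj s"
    unfolding s_def by (rule cinner_commute)
  then have "cinner w w = of_real ((cnorm cinner v)\<^sup>2) - s * cnj s / of_real (n\<^sup>2)"
    using n unfolding w_def cinner_diff_left cinner_diff_right cinner_scaleC_left cinner_scaleC_right
    by (simp add: cinner_self s_def[symmetric] n_def[symmetric] field_simps power2_eq_square)
  also have "\<dots> = of_real ((cnorm cinner v)\<^sup>2 - (cmod s)\<^sup>2 / n\<^sup>2)"
    by (simp add: complex_norm_square[symmetric])
  finally have "(cnorm cinner w)\<^sup>2 = (cnorm cinner v)\<^sup>2 - (cmod s)\<^sup>2 / n\<^sup>2"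
    unfolding cinner_self of_real_eq_iff .
  then show ?thesis
    by (simp only: w_def s_def n_def)
qed

lemma Cauchy_Schwarz_cinner_unit:
  assumes "cnorm cinner x = 1"
  shows "(cmod (cinner x y))\<^sup>2 \<le> (cnorm cinner y)\<^sup>2"
proof -
  have "x \<noteq> 0"
    using assms cnorm_eq_zero_iff[of x] by auto
  \<comment> \<open>The right-hand side is the squared norm of \<open>y\<close> minus its projection
    onto the unit vector \<open>x\<close>.\<close>
  then have "0 \<le> (cnorm cinner y)\<^sup>2 - (cmod (cinner y x))\<^sup>2"
    using cnorm_orthogonal_component_sq[of x y] assms by (metis div_by_1 power_one zero_le_power2)
  then show ?thesis
    by (simp add: cmod_cinner_commute[of x y])
qed

lemma Cauchy_Schwarz_cinner_unit_eq_iff: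
  assumes "cnorm cinner x = 1" "y \<noteq> 0"
  shows "(cmod (cinner x y))\<^sup>2 = (cnorm cinner y)\<^sup>2 \<longleftrightarrow>
    (\<exists>\<nu>. cmod \<nu> = 1 / cnorm cinner y \<and> x = scaleC \<nu> y)"
proof
  assume eq: "(cmod (cinner x y))\<^sup>2 = (cnorm cinner y)\<^sup>2"
  define c where "c = cinner y x"
  have "x \<noteq> 0"
    using assms cnorm_eq_zero_iff[of x] by auto
  then have "(cnorm cinner (y - scaleC c x))\<^sup>2 = 0"
    using cnorm_orthogonal_component_sq[of x y] assms eq
    by (simp add: c_def cmod_cinner_commute[of x y])
  then have y: "y = scaleC c x"
    by (simp add: cnorm_eq_zero_iff)
  then have "c \<noteq> 0"
    using assms by auto
  then have "cnorm cinner y = cmod c" "x = scaleC (1 / c) y"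
    using y assms by (simp_all add: cnorm_scaleC)
  then show "\<exists>\<nu>. cmod \<nu> = 1 / cnorm cinner y \<and> x = scaleC \<nu> y"
    by (metis norm_divide norm_one)
next
  assume "\<exists>\<nu>. cmod \<nu> = 1 / cnorm cinner y \<and> x = scaleC \<nu> y"
  then obtain \<nu> where \<nu>: "cmod \<nu> = 1 / cnorm cinner y" "x = scaleC \<nu> y"
    by blast
  have "cmod (cinner x y) = cnorm cinner y"
    using \<nu> assms cnorm_nonneg[of y]
    by (simp add: cinner_scaleC_left cinner_self norm_mult norm_power power2_eq_square)
  then show "(cmod (cinner x y))\<^sup>2 = (cnorm cinner y)\<^sup>2"
    by simp
qed

lemma complex_orthogonal_unit_bound:
  assumes ab: "a \<noteq> b" "\<not> dependent {a, b}" and x: "cinner x a = 0" "cnorm cinner x = 1"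
  defines "D \<equiv> (cnorm cinner a)\<^sup>2 * (cnorm cinner b)\<^sup>2 - (cmod (cinner a b))\<^sup>2"
  shows "(cmod (cinner x b))\<^sup>2 \<le> D / (cnorm cinner a)\<^sup>2"
    and "D / (cnorm cinner a)\<^sup>2 = (cmod (cinner x b))\<^sup>2 \<longleftrightarrow>
      (\<exists>\<nu>. cmod \<nu> = cnorm cinner a / sqrt D \<and>
        x = scaleC \<nu> (b - scaleC (cnj (cinner a b) / of_real ((cnorm cinner a)\<^sup>2)) a))"
proof -
  define c where "c = cnj (cinner a b) / of_real ((cnorm cinner a)\<^sup>2)"
  define y where "y = b - scaleC c a"
  have a0: "a \<noteq> 0"
    using ab dependent_zero by blast
  then have na: "0 < cnorm cinner a"
    using cnorm_nonneg[of a] cnorm_eq_zero_iff[of a] by simp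
  have "b \<notin> span {a}"
    using ab by (metis independent_insert insert_commute singletonD)
  then have y0: "y \<noteq> 0"
    by (auto simp: y_def span_singleton)
  \<comment> \<open>This matches the conjugated coefficient in the equality condition with the
    projection coefficient of \<open>b\<close> along \<open>a\<close>.\<close>
  have "cnj (cinner a b) = cinner b a"
    by (rule cinner_commute[symmetric])
  then have ny: "(cnorm cinner y)\<^sup>2 = D / (cnorm cinner a)\<^sup>2"
    using cnorm_orthogonal_component_sq[OF a0, of b] na
    by (simp add: y_def c_def D_def cmod_cinner_commute[of a b] diff_divide_distrib)
  \<comment> \<open>\<open>x\<close> is orthogonal to \<open>a\<close>, so removing a multiple of
    \<open>a\<close> from \<open>b\<close> changes nothing.\<close>
  have xy: "cinner x b = cinner x y"
    using x by (simp add: y_def cinner_diff_right cinner_scaleC_right)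
  show "(cmod (cinner x b))\<^sup>2 \<le> D / (cnorm cinner a)\<^sup>2"
    unfolding ny[symmetric] xy by (rule Cauchy_Schwarz_cinner_unit[OF x(2)])
  have "cnorm cinner a / sqrt D = 1 / cnorm cinner y"
    using ny na cnorm_nonneg by (rule norm_over_sqrt_quotient)
  then show "D / (cnorm cinner a)\<^sup>2 = (cmod (cinner x b))\<^sup>2 \<longleftrightarrow>
      (\<exists>\<nu>. cmod \<nu> = cnorm cinner a / sqrt D \<and>
        x = scaleC \<nu> (b - scaleC (cnj (cinner a b) / of_real ((cnorm cinner a)\<^sup>2)) a))"
    using Cauchy_Schwarz_cinner_unit_eq_iff[OF x(2) y0]
    unfolding ny[symmetric] xy c_def[symmetric] y_def[symmetric] by auto
qed

end

theorem theorem3: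
  shows
    "(\<forall>a b x :: 'r::real_inner.
        a \<noteq> b \<and> independent {a, b} \<longrightarrow> inner x a = 0 \<and> norm x = 1 \<longrightarrow>
          ((norm a)\<^sup>2 * (norm b)\<^sup>2 - \<bar>inner a b\<bar>\<^sup>2) / (norm a)\<^sup>2 \<ge> \<bar>inner x b\<bar>\<^sup>2 \<and>
          (((norm a)\<^sup>2 * (norm b)\<^sup>2 - \<bar>inner a b\<bar>\<^sup>2) / (norm a)\<^sup>2 = \<bar>inner x b\<bar>\<^sup>2 \<longleftrightarrow>
            (\<exists>\<nu>::real.
              \<bar>\<nu>\<bar> = norm a / sqrt ((norm a)\<^sup>2 * (norm b)\<^sup>2 - \<bar>inner a b\<bar>\<^sup>2) \<and>
              x = \<nu> *\<^sub>R (b - (inner a b / (norm a)\<^sup>2) *\<^sub>R a))))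
     \<and>
     (\<forall>(scaleC :: complex \<Rightarrow> 'c \<Rightarrow> 'c::ab_group_add) cinner.
        complex_inner_space scaleC cinner \<longrightarrow>
        (\<forall>a b x :: 'c.
          a \<noteq> b \<and> \<not> module.dependent scaleC {a, b} \<longrightarrow> cinner x a = 0 \<and> cnorm cinner x = 1 \<longrightarrow>
            ((cnorm cinner a)\<^sup>2 * (cnorm cinner b)\<^sup>2 - (cmod (cinner a b))\<^sup>2) / (cnorm cinner a)\<^sup>2
              \<ge> (cmod (cinner x b))\<^sup>2 \<and>
            (((cnorm cinner a)\<^sup>2 * (cnorm cinner b)\<^sup>2 - (cmod (cinner a b))\<^sup>2) / (cnorm cinner a)\<^sup>2
              = (cmod (cinner x b))\<^sup>2 \<longleftrightarrow>
              (\<exists>\<nu>::complex.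
                cmod \<nu> = cnorm cinner a
                  / sqrt ((cnorm cinner a)\<^sup>2 * (cnorm cinner b)\<^sup>2 - (cmod (cinner a b))\<^sup>2) \<and>
                x = scaleC \<nu>
                  (b - scaleC (cnj (cinner a b) / complex_of_real ((cnorm cinner a)\<^sup>2)) a)))))"
  \<comment> \<open>Four goals remain, the bound and the equality case over each field; outside the
    locale, the complex facts take \<open>complex_inner_space\<close> as a further premise.\<close>
  by (intro conjI allI impI; elim conjE)
    (rule real_orthogonal_unit_bound complex_inner_space.complex_orthogonal_unit_bound; assumption)+

end
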